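(* Let $\{m_{ij}\}_{1\le i<j\le n}$ be a collection of positive integers. Then the specialization $$q_{ij}\longmapsto[m_{ij}]_y:=\frac{y^{m_{ij}}-1}{y-1}$$ of the universal Tutte polynomial $T_n(\{q_{ij}\},x,y)$ is equal to the Tutte polynomial of the complete graph $K_n$ in which each edge $(i,j)$ is taken with multiplicity $m_{ij}$.
   Context: The universal Tutte polynomial $T_n(\{q_{ij}\},x,y)\in\mathbb{Z}[\{q_{ij}\}_{1\le i<j\le n},x,y]$ is defined by $$(x-1)\,T_n(\{q_{ij}\},x,y)=\mathrm{Coeff}_{[t_1\cdots t_n]}\left[\Bigl(\sum_{\ell_1,\dots,\ell_n\in\{0,1\}}\ \prod_{1\le i<j\le n}(q_{ij}(y-1)+1)^{\ell_i\ell_j}\,(y-1)^{-\sum_j\ell_j}\,t_1^{\ell_1}\cdots t_n^{\ell_n}\Bigr)^{(x-1)(y-1)}\right],$$ where $\mathrm{Coeff}_{[t_1\cdots t_n]}$ denotes the coefficient of the monomial $t_1t_2\cdots t_n$ and the power is that of a formal power series with constant term $1$. The Tutte polynomial of a graph $\Gamma=(V,E)$ is $\sum_{A\subset E}(x-1)^{\kappa(A)-\kappa(E)}(y-1)^{\kappa(A)+|A|-|V|}$, with $\kappa(A)$ the number of connected components of $(V,A)$. *)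

theory Defs
  imports
    "HOL-Library.Poly_Mapping"
    "HOL-Library.FuncSet"
    "HOL-Library.Product_Lexorder"
    "HOL-Computational_Algebra.Computational_Algebra"
begin

text \<open>
  Polynomials in commuting variables indexed by \<open>'v\<close> are finitely supported functions from
  monomials (exponent vectors) to coefficients; the ring structure is the one of
  \<^theory>\<open>HOL-Library.Poly_Mapping\<close>. The order on pairs from
  \<^theory>\<open>HOL-Library.Product_Lexorder\<close> serves only to obtain the instance
  \<^class>\<open>idom\<close> for polynomials in the variables \<open>q\<^sub>i\<^sub>j\<close>.
\<close>

type_synonym ('v, 'a) mpoly = "('v \<Rightarrow>\<^sub>0 nat) \<Rightarrow>\<^sub>0 'a"

definition mpoly_const :: "'a::zero \<Rightarrow> ('v, 'a) mpoly" where
  "mpoly_const c = Poly_Mapping.single 0 c"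

definition mpoly_var :: "'v \<Rightarrow> ('v, 'a::zero_neq_one) mpoly" where
  "mpoly_var v = Poly_Mapping.single (Poly_Mapping.single v 1) 1"

definition mpoly_vars :: "('v, 'a::zero) mpoly \<Rightarrow> 'v set" where
  "mpoly_vars p = (\<Union>\<mu>\<in>Poly_Mapping.keys p. Poly_Mapping.keys \<mu>)"

definition mpoly_eval :: "('v \<Rightarrow> 'a) \<Rightarrow> ('v, 'a::comm_semiring_1) mpoly \<Rightarrow> 'a" where
  "mpoly_eval f p =
     (\<Sum>\<mu>\<in>Poly_Mapping.keys p.
        Poly_Mapping.lookup p \<mu> *
          (\<Prod>v\<in>Poly_Mapping.keys \<mu>. f v ^ Poly_Mapping.lookup \<mu> v))"

text \<open>
  The binomial series \<open>F\<^sup>\<alpha> = \<Sum>k. (\<alpha> choose k) (F - 1)\<^sup>k\<close> of a polynomial \<open>F\<close> with constant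
  term 1, as a formal power series, i.e. the function sending each monomial to its coefficient.
  Since \<open>F - 1\<close> has no constant term, for a fixed monomial only finitely many \<open>k\<close> contribute.
\<close>

definition mpoly_fps_power ::
    "('v, 'a::field_char_0) mpoly \<Rightarrow> 'a \<Rightarrow> ('v \<Rightarrow>\<^sub>0 nat) \<Rightarrow> 'a" where
  "mpoly_fps_power F \<alpha> = (\<lambda>\<mu>.
     Sum_any (\<lambda>k. (\<alpha> gchoose k) * Poly_Mapping.lookup ((F - 1) ^ k) \<mu>))"

lemma of_nat_fract: "of_nat n = Fract (of_nat n :: 'a::idom) 1"
  by (induction n) (auto simp: Zero_fract_def One_fract_def)

instance fract :: ("{idom, ring_char_0}") field_char_0
  by standard (auto simp: inj_on_def of_nat_fract eq_fract)


text \<open>\<open>\<int>[x,y]\<close> is rendered as \<open>\<int>[x][y]\<close>, and \<open>\<int>[{q\<^sub>i\<^sub>j},x,y]\<close> as \<open>\<int>[x][y][{q\<^sub>i\<^sub>j}]\<close>.\<close>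

type_synonym xy_poly = "int poly poly"

definition xP :: xy_poly where "xP = [:[:0, 1:]:]"

definition yP :: xy_poly where "yP = [:0, 1:]"

type_synonym qxy_poly = "(nat \<times> nat, xy_poly) mpoly"

definition vertex_pairs :: "nat \<Rightarrow> (nat \<times> nat) set" where
  "vertex_pairs n = {(i, j). 1 \<le> i \<and> i < j \<and> j \<le> n}"

definition xK :: "qxy_poly fract" where "xK = to_fract (mpoly_const xP)"

definition yK :: "qxy_poly fract" where "yK = to_fract (mpoly_const yP)"

definition qK :: "nat \<times> nat \<Rightarrow> qxy_poly fract" where "qK e = to_fract (mpoly_var e)"

text \<open>The base of the power: a polynomial in \<open>t\<^sub>1, \<dots>, t\<^sub>n\<close> over the field of fractions
  of \<open>\<int>[{q\<^sub>i\<^sub>j},x,y]\<close>.\<close>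

definition tutte_base :: "nat \<Rightarrow> (nat, qxy_poly fract) mpoly" where
  "tutte_base n =
     (\<Sum>l \<in> {1..n} \<rightarrow>\<^sub>E {0, 1::nat}.
        mpoly_const
          ((\<Prod>(i, j)\<in>vertex_pairs n. (qK (i, j) * (yK - 1) + 1) ^ (l i * l j)) *
           (yK - 1) powi (- int (\<Sum>j = 1..n. l j))) *
        (\<Prod>j = 1..n. mpoly_var j ^ l j))"

definition universal_tutte :: "nat \<Rightarrow> qxy_poly" where
  "universal_tutte n =
     (THE T. mpoly_vars T \<subseteq> vertex_pairs n \<and>
        (xK - 1) * to_fract T =
          mpoly_fps_power (tutte_base n) ((xK - 1) * (yK - 1))
            (\<Sum>j = 1..n. Poly_Mapping.single j 1))"

text \<open>Exact division of polynomials.\<close>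

definition q_number :: "nat \<Rightarrow> xy_poly" where
  "q_number m = (yP ^ m - 1) div (yP - 1)"


text \<open>Undirected multigraphs: \<open>mg_ends e\<close> is the set of the (one or two) end points of \<open>e\<close>.\<close>

record ('v, 'e) multigraph =
  mg_verts :: "'v set"
  mg_edges :: "'e set"
  mg_ends :: "'e \<Rightarrow> 'v set"

definition mg_connected :: "('v, 'e) multigraph \<Rightarrow> 'e set \<Rightarrow> ('v \<times> 'v) set" where
  "mg_connected G A =
     {(u, v). \<exists>e\<in>A. mg_ends G e = {u, v}}\<^sup>* \<inter> mg_verts G \<times> mg_verts G"

definition num_components :: "('v, 'e) multigraph \<Rightarrow> 'e set \<Rightarrow> nat" where
  "num_components G A = card (mg_verts G // mg_connected G A)"

text \<open>For a finite multigraph with end points in its vertex set, neither of the two subtractions of natural numbers truncates.\<close>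

definition tutte_poly :: "('v, 'e) multigraph \<Rightarrow> xy_poly" where
  "tutte_poly G =
     (\<Sum>A \<in> Pow (mg_edges G).
        (xP - 1) ^ (num_components G A - num_components G (mg_edges G)) *
        (yP - 1) ^ (num_components G A + card A - card (mg_verts G)))"

text \<open>The edge \<open>(i, j, k)\<close> is the \<open>k\<close>-th of the \<open>m i j\<close> parallel edges joining \<open>i < j\<close>.\<close>

definition complete_multigraph ::
    "nat \<Rightarrow> (nat \<Rightarrow> nat \<Rightarrow> nat) \<Rightarrow> (nat, nat \<times> nat \<times> nat) multigraph" where
  "complete_multigraph n m =
     \<lparr> mg_verts = {1..n},
       mg_edges = {(i, j, k). (i, j) \<in> vertex_pairs n \<and> 1 \<le> k \<and> k \<le> m i j},
       mg_ends = (\<lambda>(i, j, k). {i, j}) \<rparr>"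

end

theory Submission
  imports Defs
begin

text \<open>
  The coefficient of \<open>t\<^sub>1 \<dots> t\<^sub>n\<close> in \<open>F\<^sup>\<alpha>\<close> is a polynomial in \<open>\<alpha>\<close>. For \<open>\<alpha> = N\<close> a natural number it is
  \<open>(y - 1)^(-n)\<close> times a sum over all colourings of the vertices with \<open>N\<close> colours, where each
  monochromatic edge \<open>e\<close> has weight \<open>1 + q\<^sub>e (y - 1)\<close>. Expanding these products over edge sets \<open>A\<close>
  and using that \<open>N^\<kappa>(A)\<close> colourings are constant along \<open>A\<close>, one obtains
  \<open>T\<^sub>n = \<Sum>A. (x - 1)^(\<kappa>(A) - 1) (y - 1)^(\<kappa>(A) + |A| - n) \<Prod>e\<in>A. q\<^sub>e\<close>.
  The sum of \<open>(y - 1)^|X|\<close> over the nonempty sets \<open>X\<close> of edges parallel to \<open>e\<close> is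
  \<open>y^m - 1 = (y - 1) [m]\<^sub>y\<close>, so under the specialization the term of \<open>A\<close> becomes the sum over all
  sets of parallel edges lying over \<open>A\<close>.
\<close>

section \<open>Connected components and colourings\<close>

text \<open>Edges are ordered pairs, hence the symmetrization by \<open>A\<inverse>\<close>; cutting
  down to \<open>V \<times> V\<close> turns the closure into an equivalence relation on
  \<open>V\<close>. Simple edge sets and projections of sets of parallel edges both take this
  form.\<close>

definition connected_pairs :: "'a set \<Rightarrow> ('a \<times> 'a) set \<Rightarrow> ('a \<times> 'a) set" where
  "connected_pairs V A = (A \<union> A\<inverse>)\<^sup>* \<inter> V \<times> V"

definition components :: "'a set \<Rightarrow> ('a \<times> 'a) set \<Rightarrow> 'a set set" where
  "components V A = V // connected_pairs V A"

lemma equiv_connected_pairs: "equiv V (connected_pairs V A)"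
proof (rule equivI)
  show "refl_on V (connected_pairs V A)"
    by (auto simp: refl_on_def connected_pairs_def)
  have "sym ((A \<union> A\<inverse>)\<^sup>*)"
    by (intro sym_rtrancl) (auto simp: sym_def)
  then show "sym (connected_pairs V A)"
    by (auto simp: connected_pairs_def sym_def)
  show "trans (connected_pairs V A)"
    by (auto simp: connected_pairs_def trans_def)
qed (auto simp: connected_pairs_def)

lemma finite_components: "finite V \<Longrightarrow> finite (components V A)"
  unfolding components_def by (rule finite_quotient) (auto simp: connected_pairs_def)

lemma colouring_constant_on_component:
  assumes "(u, v) \<in> connected_pairs V A" and "\<forall>(i, j)\<in>A. \<chi> i = \<chi> j"
  shows "\<chi> u = \<chi> v"
proof -
  have "(u, v) \<in> (A \<union> A\<inverse>)\<^sup>*"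
    using assms(1) by (simp add: connected_pairs_def)
  then show ?thesis
    by (induction rule: rtrancl_induct) (use assms(2) in auto)
qed

lemma edge_connected_pairs: "(i, j) \<in> A \<Longrightarrow> A \<subseteq> V \<times> V \<Longrightarrow> (i, j) \<in> connected_pairs V A"
  by (auto simp: connected_pairs_def)

text \<open>A colouring that agrees along every edge of \<open>A\<close> is constant on each
  component, so it amounts to a free choice of one colour per component.\<close>

lemma card_colourings:
  assumes "finite V" "A \<subseteq> V \<times> V"
  shows "card {\<chi> \<in> V \<rightarrow>\<^sub>E C. \<forall>(i, j)\<in>A. \<chi> i = \<chi> j} = card C ^ card (components V A)"
proof -
  let ?R = "connected_pairs V A"
  let ?f = "\<lambda>h. \<lambda>v\<in>V. h (?R `` {v})"
  note eq = equiv_connected_pairs[of V A]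
  have "bij_betw ?f (components V A \<rightarrow>\<^sub>E C) {\<chi> \<in> V \<rightarrow>\<^sub>E C. \<forall>(i, j)\<in>A. \<chi> i = \<chi> j}"
  proof (rule bij_betwI')
    fix h h' assume h: "h \<in> components V A \<rightarrow>\<^sub>E C" and h': "h' \<in> components V A \<rightarrow>\<^sub>E C"
    show "?f h = ?f h' \<longleftrightarrow> h = h'"
    proof
      assume f: "?f h = ?f h'"
      show "h = h'"
      proof (rule PiE_ext[OF h h'])
        fix X assume "X \<in> components V A"
        then obtain v where "v \<in> V" "X = ?R `` {v}"
          by (auto simp: components_def elim: quotientE)
        then show "h X = h' X"
          using fun_cong[OF f, of v] by simp
      qed
    qed simp
  next
    fix h assume h: "h \<in> components V A \<rightarrow>\<^sub>E C"
    have "?f h i = ?f h j" if "(i, j) \<in> A" for i j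
    proof -
      have "?R `` {i} = ?R `` {j}"
        using equiv_class_eq[OF eq edge_connected_pairs[OF that assms(2)]] .
      then show ?thesis using that assms(2) by auto
    qed
    then show "?f h \<in> {\<chi> \<in> V \<rightarrow>\<^sub>E C. \<forall>(i, j)\<in>A. \<chi> i = \<chi> j}"
      using h by (auto simp: components_def intro: quotientI PiE_mem)
  next
    fix \<chi> assume \<chi>: "\<chi> \<in> {\<chi> \<in> V \<rightarrow>\<^sub>E C. \<forall>(i, j)\<in>A. \<chi> i = \<chi> j}"
    \<comment> \<open>The colour of a component is read off at an arbitrary representative;
      constancy on components makes the choice harmless.\<close>
    let ?h = "\<lambda>X\<in>components V A. \<chi> (SOME v. v \<in> X)"
    have *: "X \<in> components V A \<Longrightarrow> (SOME v. v \<in> X) \<in> X" for X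
      unfolding components_def by (metis ex_in_conv[of X] someI_ex in_quotient_imp_non_empty[OF eq])
    have sub: "X \<in> components V A \<Longrightarrow> X \<subseteq> V" for X
      unfolding components_def by (rule in_quotient_imp_subset[OF eq])
    have "?h \<in> components V A \<rightarrow>\<^sub>E C"
    proof (rule restrict_PiE_iff[THEN iffD2], rule ballI)
      fix X assume "X \<in> components V A"
      with * sub have "(SOME v. v \<in> X) \<in> V" by blast
      then show "\<chi> (SOME v. v \<in> X) \<in> C" using \<chi> by blast
    qed
    moreover have "\<chi> = ?f ?h"
    proof
      fix v
      show "\<chi> v = ?f ?h v"
      proof (cases "v \<in> V")
        case True
        then have X: "?R `` {v} \<in> components V A"
          by (auto simp: components_def intro: quotientI)
        have "(v, SOME u. u \<in> ?R `` {v}) \<in> ?R"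
          using *[OF X] by simp
        then have "\<chi> v = \<chi> (SOME u. u \<in> ?R `` {v})"
          using \<chi> by (intro colouring_constant_on_component) auto
        then show ?thesis using True X by simp
      qed (use \<chi> in auto)
    qed
    ultimately show "\<exists>h \<in> components V A \<rightarrow>\<^sub>E C. \<chi> = ?f h" by blast
  qed
  from bij_betw_same_card[OF this] show ?thesis
    using finite_components[OF assms(1)] by (simp add: card_funcsetE)
qed

text \<open>A new edge merges at most two components. Sending each old component to the new one
  containing it is injective once the component of \<open>j\<close> is set aside.\<close>

lemma card_components_insert:
  assumes "finite V" "A \<subseteq> V \<times> V" "i \<in> V" "j \<in> V"
  shows "card (components V A) \<le> Suc (card (components V (insert (i, j) A)))"
proof -
  let ?R = "connected_pairs V A" and ?B = "insert (i, j) A"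
  let ?S = "connected_pairs V ?B"
  note eR = equiv_connected_pairs[of V A] and eS = equiv_connected_pairs[of V ?B]
  have sub: "?R \<subseteq> ?S"
    unfolding connected_pairs_def by (intro Int_mono rtrancl_mono) auto
  \<comment> \<open>A walk that uses the new edge can be shortened to cross it at most once. After
    one crossing, in either direction, one end of the walk is joined to \<open>j\<close> by old
    edges alone.\<close>
  have key: "(u, v) \<in> ?R \<or> (u, j) \<in> ?R \<or> (v, j) \<in> ?R" if "(u, v) \<in> ?S" for u v
  proof -
    have uv: "u \<in> V" "v \<in> V" and "(u, v) \<in> (?B \<union> ?B\<inverse>)\<^sup>*"
      using that by (auto simp: connected_pairs_def)
    from this(3) have "(u, v) \<in> (A \<union> A\<inverse>)\<^sup>* \<or>
        (u, i) \<in> (A \<union> A\<inverse>)\<^sup>* \<and> (j, v) \<in> (A \<union> A\<inverse>)\<^sup>* \<or>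
        (u, j) \<in> (A \<union> A\<inverse>)\<^sup>* \<and> (i, v) \<in> (A \<union> A\<inverse>)\<^sup>*"
    proof (induction rule: rtrancl_induct)
      case (step y z)
      then consider "(y, z) \<in> A \<union> A\<inverse>" | "y = i" "z = j" | "y = j" "z = i" by auto
      then show ?case
        using step.IH by cases (auto intro: rtrancl_into_rtrancl)
    qed simp
    then have "(u, v) \<in> ?R \<or> (u, j) \<in> ?R \<or> (j, v) \<in> ?R"
      using uv assms(4) by (auto simp: connected_pairs_def)
    then show ?thesis using eR by (meson equivE symD)
  qed
  let ?f = "\<lambda>X. ?S `` X"
  have cls: "?f (?R `` {v}) = ?S `` {v}" if "v \<in> V" for v
  proof -
    have "(v, v) \<in> ?R"
      using eR that by (auto simp: equiv_def refl_on_def)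
    moreover have "(v, w) \<in> ?S" if "(v, x) \<in> ?R" "(x, w) \<in> ?S" for x w
      using that sub eS by (meson equivE subsetD transD)
    ultimately show ?thesis by blast
  qed
  have inj: "inj_on ?f (components V A - {?R `` {j}})"
  proof (rule inj_onI)
    fix X Y assume X: "X \<in> components V A - {?R `` {j}}" and Y: "Y \<in> components V A - {?R `` {j}}"
      and f: "?f X = ?f Y"
    obtain u v where u: "u \<in> V" "X = ?R `` {u}" and v: "v \<in> V" "Y = ?R `` {v}"
      using X Y by (auto simp: components_def elim!: quotientE)
    have "(u, v) \<in> ?S"
      using f cls u v eq_equiv_class[OF _ eS] by simp
    from key[OF this] show "X = Y"
      using X Y u v equiv_class_eq[OF eR] by auto
  qed
  have "?f ` (components V A - {?R `` {j}}) \<subseteq> components V ?B"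
    using cls by (auto simp: components_def elim!: quotientE intro: quotientI)
  then have "card (components V A - {?R `` {j}}) \<le> card (components V ?B)"
    using card_inj_on_le[OF inj] finite_components[OF assms(1)] by blast
  then show ?thesis
    using card_Diff1_le[of "components V A"] finite_components[OF assms(1), of A]
    by (cases "?R `` {j} \<in> components V A") (auto simp: card_Diff_singleton_if)
qed

lemma components_empty: "components V {} = (\<lambda>v. {v}) ` V"
  by (auto simp: components_def connected_pairs_def quotient_def)

text \<open>Starting from isolated vertices, each edge lowers the number of components by at most
  one. This is what keeps the exponent \<kappa>(A) + |A| - n from truncating.\<close>

lemma card_le_components_plus_edges:
  assumes "finite V" "finite A" "A \<subseteq> V \<times> V"
  shows "card V \<le> card (components V A) + card A"
  using assms(2,3)
proof (induction A rule: finite_induct)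
  case empty
  show ?case by (simp add: components_empty card_image)
next
  case (insert e A)
  then show ?case
    using card_components_insert[OF assms(1), of A "fst e" "snd e"] by auto
qed

lemma card_components_pos:
  assumes "finite V" "V \<noteq> {}"
  shows "card (components V A) > 0"
  using assms finite_components[OF assms(1), of A] by (simp add: card_gt_0_iff components_def)

section \<open>Coefficients of powers\<close>

lemma prod_single:
  "(\<Prod>c\<in>C. Poly_Mapping.single (M c) (f c)) =
     Poly_Mapping.single (\<Sum>c\<in>C. M c :: 'v \<Rightarrow>\<^sub>0 nat) (\<Prod>c\<in>C. f c :: 'a::comm_semiring_1)"
  by (induction C rule: infinite_finite_induct) (simp_all add: mult_single)

lemma power_sum_single:
  assumes "finite L"
  shows "(\<Sum>l\<in>L. Poly_Mapping.single (M l) (f l)) ^ k =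
    (\<Sum>g \<in> {..<k} \<rightarrow>\<^sub>E L. Poly_Mapping.single (\<Sum>c<k. M (g c) :: 'v \<Rightarrow>\<^sub>0 nat)
       (\<Prod>c<k. f (g c) :: 'a::comm_semiring_1))"
  using prod_sum_PiE[of "{..<k}" "\<lambda>_. L" "\<lambda>_ l. Poly_Mapping.single (M l) (f l)"] assms
  by (simp add: prod_single)

text \<open>Serves for both families of variables: with \<open>V = {1..n}\<close> for monomials in
  the t's, and with an edge set in place of \<open>V\<close> for monomials in the q's. The constant
  function 1 gives the squarefree monomial of the set.\<close>

definition exponent :: "'v set \<Rightarrow> ('v \<Rightarrow> nat) \<Rightarrow> 'v \<Rightarrow>\<^sub>0 nat" where
  "exponent V l = (\<Sum>j\<in>V. Poly_Mapping.single j (l j))"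

lemma lookup_exponent:
  "finite V \<Longrightarrow> Poly_Mapping.lookup (exponent V l) v = (if v \<in> V then l v else 0)"
  by (simp add: exponent_def lookup_sum lookup_single when_def)

lemma exponent_eq_iff:
  "finite V \<Longrightarrow> exponent V l = exponent V l' \<longleftrightarrow> (\<forall>v\<in>V. l v = l' v)"
  by (auto simp: poly_mapping_eq_iff lookup_exponent fun_eq_iff)

lemma sum_exponent: "(\<Sum>c\<in>C. exponent V (g c)) = exponent V (\<lambda>j. \<Sum>c\<in>C. g c j)"
proof -
  have "(\<Sum>c\<in>C. Poly_Mapping.single j (g c j)) = Poly_Mapping.single j (\<Sum>c\<in>C. g c j)" for j
    by (induction C rule: infinite_finite_induct) (simp_all add: single_add)
  then show ?thesis
    unfolding exponent_def by (subst sum.swap) simp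
qed

lemma lookup_power_sum_exponent:
  fixes f :: "('v \<Rightarrow> nat) \<Rightarrow> 'a::comm_semiring_1"
  assumes "finite V" "finite L"
  shows "Poly_Mapping.lookup ((\<Sum>l\<in>L. Poly_Mapping.single (exponent V l) (f l)) ^ k) (exponent V e) =
    (\<Sum>g \<in> {g \<in> {..<k} \<rightarrow>\<^sub>E L. \<forall>j\<in>V. (\<Sum>c<k. g c j) = e j}. \<Prod>c<k. f (g c))"
proof -
  have "finite ({..<k} \<rightarrow>\<^sub>E L)"
    using assms by (intro finite_PiE) auto
  then show ?thesis
    using assms
    by (simp add: power_sum_single lookup_sum lookup_single sum_exponent when_def exponent_eq_iff
        sum.inter_filter)
qed

text \<open>To produce the squarefree monomial from \<open>N\<close> factors, each variable must be
  taken from exactly one factor. The index of that factor is the colour of the vertex.\<close>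

lemma bij_betw_colourings:
  fixes N :: nat
  assumes "finite V"
  shows "bij_betw (\<lambda>\<chi>. \<lambda>c\<in>{..<N}. \<lambda>j\<in>V. of_bool (\<chi> j = c)) (V \<rightarrow>\<^sub>E {..<N})
    {g \<in> {..<N} \<rightarrow>\<^sub>E V \<rightarrow>\<^sub>E {0, 1::nat}. \<forall>j\<in>V. (\<Sum>c<N. g c j) = 1}"
    (is "bij_betw ?F _ _")
proof (rule bij_betwI')
  fix \<chi> \<psi> assume \<chi>: "\<chi> \<in> V \<rightarrow>\<^sub>E {..<N}" and \<psi>: "\<psi> \<in> V \<rightarrow>\<^sub>E {..<N}"
  show "?F \<chi> = ?F \<psi> \<longleftrightarrow> \<chi> = \<psi>"
  proof
    assume F: "?F \<chi> = ?F \<psi>"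
    show "\<chi> = \<psi>"
    proof (rule PiE_ext[OF \<chi> \<psi>])
      fix j assume j: "j \<in> V"
      then have "\<chi> j < N" using \<chi> by auto
      then show "\<chi> j = \<psi> j"
        using fun_cong[OF fun_cong[OF F, of "\<chi> j"], of j] j by (auto simp: of_bool_def split: if_splits)
    qed
  qed simp
next
  fix \<chi> assume \<chi>: "\<chi> \<in> V \<rightarrow>\<^sub>E {..<N}"
  have "(\<Sum>c<N. ?F \<chi> c j) = 1" if "j \<in> V" for j
  proof -
    have "\<chi> j < N" using \<chi> that by auto
    then show ?thesis using that by (simp add: of_bool_def)
  qed
  then show "?F \<chi> \<in> {g \<in> {..<N} \<rightarrow>\<^sub>E V \<rightarrow>\<^sub>E {0, 1::nat}. \<forall>j\<in>V. (\<Sum>c<N. g c j) = 1}"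
    by auto
next
  fix g assume g: "g \<in> {g \<in> {..<N} \<rightarrow>\<^sub>E V \<rightarrow>\<^sub>E {0, 1::nat}. \<forall>j\<in>V. (\<Sum>c<N. g c j) = 1}"
  \<comment> \<open>Natural numbers with sum 1 are all 0 except for a single 1, whose position is
    the colour of \<open>j\<close>.\<close>
  have "\<forall>j\<in>V. \<exists>c<N. \<forall>d<N. g d j = of_bool (c = d)"
  proof
    fix j assume "j \<in> V"
    then have "(\<Sum>c<N. g c j) = 1" using g by blast
    then obtain c where "c < N" "g c j = 1" "\<forall>d\<in>{..<N}. c \<noteq> d \<longrightarrow> g d j = 0"
      using sum_eq_1_iff[of "{..<N}" "\<lambda>c. g c j"] by auto
    then show "\<exists>c<N. \<forall>d<N. g d j = of_bool (c = d)"
      by (auto intro!: exI[of _ c])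
  qed
  then obtain p where p: "\<And>j. j \<in> V \<Longrightarrow> p j < N" "\<And>j d. j \<in> V \<Longrightarrow> d < N \<Longrightarrow> g d j = of_bool (p j = d)"
    by metis
  have "g = ?F (restrict p V)"
  proof
    fix c
    show "g c = ?F (restrict p V) c"
    proof (cases "c < N")
      case True
      then have "g c \<in> V \<rightarrow>\<^sub>E {0, 1}" using g by blast
      then show ?thesis
        by (rule PiE_ext[where k = V and s = "\<lambda>_. {0, 1}"])
            (use True p(2) in auto)
    qed (use g in auto)
  qed
  moreover have "restrict p V \<in> V \<rightarrow>\<^sub>E {..<N}" using p(1) by auto
  ultimately show "\<exists>\<chi> \<in> V \<rightarrow>\<^sub>E {..<N}. g = ?F \<chi>" by blast
qed

lemma lookup_power_colourings:
  fixes f :: "('v \<Rightarrow> nat) \<Rightarrow> 'a::comm_semiring_1"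
  assumes "finite V"
  shows "Poly_Mapping.lookup ((\<Sum>l \<in> V \<rightarrow>\<^sub>E {0, 1}. Poly_Mapping.single (exponent V l) (f l)) ^ N)
      (exponent V (\<lambda>_. 1)) =
    (\<Sum>\<chi> \<in> V \<rightarrow>\<^sub>E {..<N}. \<Prod>c<N. f (\<lambda>j\<in>V. of_bool (\<chi> j = c)))"
proof -
  have "finite (V \<rightarrow>\<^sub>E {0, 1::nat})"
    using assms by (intro finite_PiE) auto
  then show ?thesis
    using assms
    by (simp add: lookup_power_sum_exponent sum.reindex_bij_betw[OF bij_betw_colourings, symmetric]
        del: One_nat_def restrict_apply)
      (intro sum.cong prod.cong; simp)
qed

text \<open>Subtracting 1 removes the constant term, so the \<open>k\<close>-th power has only terms
  of degree at least \<open>k\<close>, while the monomial in question has degree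
  \<open>card V\<close>. Hence the binomial series is a finite sum at this monomial.\<close>

lemma lookup_power_minus_1_eq_0:
  fixes f :: "('v \<Rightarrow> nat) \<Rightarrow> 'a::comm_ring_1"
  assumes "finite V" "f (\<lambda>_\<in>V. 0) = 1" "card V < k"
  shows "Poly_Mapping.lookup
      (((\<Sum>l \<in> V \<rightarrow>\<^sub>E {0, 1}. Poly_Mapping.single (exponent V l) (f l)) - 1) ^ k)
      (exponent V (\<lambda>_. 1)) = 0"
proof -
  let ?L = "V \<rightarrow>\<^sub>E {0, 1::nat}" and ?z = "\<lambda>_\<in>V. 0::nat"
  have fin: "finite ?L"
    using assms by (intro finite_PiE) auto
  have "exponent V ?z = 0"
    by (simp add: exponent_def)
  then have F: "(\<Sum>l\<in>?L. Poly_Mapping.single (exponent V l) (f l)) - 1 =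
      (\<Sum>l \<in> ?L - {?z}. Poly_Mapping.single (exponent V l) (f l))"
    using fin assms(2) by (subst sum.remove[of _ ?z]) auto
  have "{g \<in> {..<k} \<rightarrow>\<^sub>E ?L - {?z}. \<forall>j\<in>V. (\<Sum>c<k. g c j) = 1} = {}"
  proof (rule equals0I, clarify)
    fix g assume g: "g \<in> {..<k} \<rightarrow>\<^sub>E ?L - {?z}" and s: "\<forall>j\<in>V. (\<Sum>c<k. g c j) = 1"
    \<comment> \<open>Each of the \<open>k\<close> chosen exponent vectors is nonzero. Summing the
      total degree by factors gives at least \<open>k\<close>, by vertices exactly
      \<open>card V\<close>.\<close>
    have "1 \<le> (\<Sum>j\<in>V. g c j)" if "c < k" for c
    proof (rule ccontr)
      assume "\<not> 1 \<le> (\<Sum>j\<in>V. g c j)"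
      then have "\<forall>j\<in>V. g c j = 0" using assms(1) by (simp add: not_le)
      moreover have "g c \<in> ?L - {?z}" using PiE_mem[OF g, of c] that by simp
      ultimately show False
        using PiE_ext[where x = "g c" and y = ?z and k = V and s = "\<lambda>_. {0, 1}"] by auto
    qed
    then have "(\<Sum>c<k. 1) \<le> (\<Sum>c<k. \<Sum>j\<in>V. g c j)"
      by (intro sum_mono) auto
    also have "\<dots> = (\<Sum>j\<in>V. \<Sum>c<k. g c j)" by (rule sum.swap)
    also have "\<dots> = card V" using s by simp
    finally show False using assms(3) by simp
  qed
  with lookup_power_sum_exponent[OF assms(1), of "?L - {?z}" f k "\<lambda>_. 1"] fin
  show ?thesis unfolding F by (simp del: One_nat_def)
qed

text \<open>The binomial coefficients vanish beyond \<open>k = N\<close>, and what remains is the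
  binomial theorem for \<open>(F - 1) + 1\<close>.\<close>

lemma mpoly_fps_power_of_nat:
  fixes F :: "('v, 'a::field_char_0) mpoly"
  assumes "\<And>k. n < k \<Longrightarrow> Poly_Mapping.lookup ((F - 1) ^ k) \<mu> = 0"
  shows "mpoly_fps_power F (of_nat N) \<mu> = Poly_Mapping.lookup (F ^ N) \<mu>"
proof -
  have "mpoly_fps_power F (of_nat N) \<mu> =
      (\<Sum>k\<le>N. of_nat (N choose k) * Poly_Mapping.lookup ((F - 1) ^ k) \<mu>)"
    unfolding mpoly_fps_power_def binomial_gbinomial[symmetric]
  proof (rule Sum_any.expand_superset)
    show "{k. of_nat (N choose k) * Poly_Mapping.lookup ((F - 1) ^ k) \<mu> \<noteq> 0} \<subseteq> {..N}"
      by (auto simp: not_le[symmetric])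
  qed simp
  also have "\<dots> = Poly_Mapping.lookup (\<Sum>k\<le>N. of_nat (N choose k) * (F - 1) ^ k) \<mu>"
  proof -
    have "of_nat m * Poly_Mapping.lookup p \<mu> = Poly_Mapping.lookup (of_nat m * p) \<mu>"
      for m and p :: "('v, 'a) mpoly"
      by (induction m) (simp_all add: distrib_right lookup_add)
    then show ?thesis by (simp add: lookup_sum)
  qed
  also have "(\<Sum>k\<le>N. of_nat (N choose k) * (F - 1) ^ k) = F ^ N"
    using binomial_ring[of "F - 1" 1 N] by simp
  finally show ?thesis .
qed

text \<open>The coefficients of \<open>F\<^sup>\<alpha>\<close> are polynomials in \<open>\<alpha>\<close>, so they are determined by the
  values at natural numbers \<open>\<alpha>\<close>.\<close>

lemma mpoly_fps_power_eqI:
  fixes F :: "('v, 'a::field_char_0) mpoly"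
  assumes "\<And>k. n < k \<Longrightarrow> Poly_Mapping.lookup ((F - 1) ^ k) \<mu> = 0"
    and "\<And>N. Poly_Mapping.lookup (F ^ N) \<mu> = poly p (of_nat N)"
  shows "mpoly_fps_power F \<alpha> \<mu> = poly p \<alpha>"
proof -
  \<comment> \<open>The truncated binomial series, with each generalized binomial coefficient
    written as a falling factorial over \<open>fact k\<close>, hence a polynomial in the
    exponent.\<close>
  define r where "r = (\<Sum>k\<le>n. smult (Poly_Mapping.lookup ((F - 1) ^ k) \<mu> / fact k)
    (\<Prod>i<k. [:- of_nat i, 1:]))"
  have r: "mpoly_fps_power F \<beta> \<mu> = poly r \<beta>" for \<beta>
  proof -
    have "mpoly_fps_power F \<beta> \<mu> =
        (\<Sum>k\<le>n. (\<beta> gchoose k) * Poly_Mapping.lookup ((F - 1) ^ k) \<mu>)"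
      unfolding mpoly_fps_power_def
    proof (rule Sum_any.expand_superset)
      show "{k. (\<beta> gchoose k) * Poly_Mapping.lookup ((F - 1) ^ k) \<mu> \<noteq> 0} \<subseteq> {..n}"
        using assms(1) by (auto simp: not_le[symmetric])
    qed simp
    also have "\<dots> = poly r \<beta>"
      unfolding r_def poly_sum
      by (intro sum.cong) (simp_all add: poly_prod gbinomial_prod_rev atLeast0LessThan)
    finally show ?thesis .
  qed
  have "r - p = 0"
  proof (rule ccontr)
    assume "r - p \<noteq> 0"
    then have "finite {x. poly (r - p) x = 0}" by (rule poly_roots_finite)
    moreover have "range of_nat \<subseteq> {x. poly (r - p) x = 0}"
      using assms mpoly_fps_power_of_nat[of n F \<mu>] by (auto simp flip: r)
    ultimately have "finite (range (of_nat :: nat \<Rightarrow> 'a))" by (rule rev_finite_subset)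
    then show False using infinite_UNIV_nat finite_imageD[OF _ inj_of_nat] by blast
  qed
  then show ?thesis using r by simp
qed

text \<open>This is the Fortuin-Kasteleyn expansion of a Potts partition function. For exponent
  \<open>N\<close>, a colouring weighs \<open>w e\<close> for each monochromatic edge; writing
  \<open>w e = (w e - 1) + 1\<close> and expanding over edge sets \<open>A\<close> leaves the number
  of colourings constant along \<open>A\<close>, a power of \<open>N\<close>. Agreement at all
  \<open>N\<close> then settles every \<alpha>.\<close>

lemma mpoly_fps_power_components:
  fixes w :: "'v \<times> 'v \<Rightarrow> 'a::field_char_0" and f :: "('v \<Rightarrow> nat) \<Rightarrow> 'a"
  assumes "finite V" "P \<subseteq> V \<times> V"
    and f: "\<And>l. f l = (\<Prod>(i, j)\<in>P. w (i, j) ^ (l i * l j)) * Y powi (- int (\<Sum>j\<in>V. l j))"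
  shows "mpoly_fps_power (\<Sum>l \<in> V \<rightarrow>\<^sub>E {0, 1}. Poly_Mapping.single (exponent V l) (f l)) \<alpha>
      (exponent V (\<lambda>_. 1)) =
    (\<Sum>A \<in> Pow P. (\<Prod>e\<in>A. w e - 1) * \<alpha> ^ card (components V A)) / Y ^ card V"
proof -
  have finP: "finite P" using assms by (meson finite_SigmaI finite_subset)
  have f1: "f (\<lambda>_\<in>V. 0) = 1"
    using assms(2) unfolding f by (simp add: case_prod_unfold) (auto intro!: prod.neutral)
  have val: "(\<Prod>c<N. f (\<lambda>j\<in>V. of_bool (\<chi> j = c))) =
      (\<Sum>A\<in>Pow P. if \<forall>(i, j)\<in>A. \<chi> i = \<chi> j then \<Prod>e\<in>A. w e - 1 else 0) * inverse Y ^ card V"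
    if \<chi>: "\<chi> \<in> V \<rightarrow>\<^sub>E {..<N}" for \<chi> and N :: nat
  proof -
    have lt: "\<chi> i < N" if "i \<in> V" for i using \<chi> that by auto
    have "(\<Prod>c<N. f (\<lambda>j\<in>V. of_bool (\<chi> j = c))) =
      (\<Prod>c<N. \<Prod>(i, j)\<in>P. w (i, j) ^ of_bool (\<chi> i = c \<and> \<chi> j = c)) *
      (\<Prod>c<N. inverse Y ^ (\<Sum>j\<in>V. of_bool (\<chi> j = c)))"
      unfolding prod.distrib[symmetric]
    proof (rule prod.cong[OF refl])
      fix c
      have "(\<Prod>(i, j)\<in>P. w (i, j) ^ ((\<lambda>j\<in>V. of_bool (\<chi> j = c)) i * (\<lambda>j\<in>V. of_bool (\<chi> j = c)) j)) =
        (\<Prod>(i, j)\<in>P. w (i, j) ^ of_bool (\<chi> i = c \<and> \<chi> j = c))"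
        using assms(2) by (intro prod.cong) (auto simp: of_bool_conj)
      moreover have "Y powi (- int (\<Sum>j\<in>V. (\<lambda>j\<in>V. of_bool (\<chi> j = c)) j)) =
          inverse Y ^ (\<Sum>j\<in>V. of_bool (\<chi> j = c))"
        unfolding power_int_minus power_int_of_nat by (simp add: power_inverse)
      ultimately show "f (\<lambda>j\<in>V. of_bool (\<chi> j = c)) =
        (\<Prod>(i, j)\<in>P. w (i, j) ^ of_bool (\<chi> i = c \<and> \<chi> j = c)) *
        inverse Y ^ (\<Sum>j\<in>V. of_bool (\<chi> j = c))"
        unfolding f by simp
    qed
    \<comment> \<open>Every vertex lies in exactly one colour class.\<close>
    also have "(\<Prod>c<N. inverse Y ^ (\<Sum>j\<in>V. of_bool (\<chi> j = c))) = inverse Y ^ card V"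
    proof -
      have "(\<Sum>c<N. \<Sum>j\<in>V. of_bool (\<chi> j = c)) = (\<Sum>j\<in>V. \<Sum>c<N. of_bool (\<chi> j = c) :: nat)"
        by (rule sum.swap)
      also have "\<dots> = (\<Sum>j\<in>V. 1)"
        using lt by (intro sum.cong) (auto simp: of_bool_def)
      finally show ?thesis by (simp add: power_sum[symmetric])
    qed
    \<comment> \<open>Edge by edge, only the colour \<open>\<chi> i\<close> can contribute a factor
      other than 1, and it does so only if the edge is monochromatic.\<close>
    also have "(\<Prod>c<N. \<Prod>(i, j)\<in>P. w (i, j) ^ of_bool (\<chi> i = c \<and> \<chi> j = c)) =
        (\<Prod>e\<in>P. (if \<chi> (fst e) = \<chi> (snd e) then w e - 1 else 0) + 1)"
    proof (subst prod.swap, rule prod.cong[OF refl], clarify)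
      fix i j assume "(i, j) \<in> P"
      then have "\<chi> i < N" using lt assms(2) by auto
      then have "(\<Prod>c<N. w (i, j) ^ of_bool (\<chi> i = c \<and> \<chi> j = c)) =
          (\<Prod>c\<in>{\<chi> i}. w (i, j) ^ of_bool (\<chi> i = c \<and> \<chi> j = c))"
        by (intro prod.mono_neutral_right) auto
      then show "(\<Prod>c<N. w (i, j) ^ of_bool (\<chi> i = c \<and> \<chi> j = c)) =
          (if \<chi> (fst (i, j)) = \<chi> (snd (i, j)) then w (i, j) - 1 else 0) + 1"
        by auto
    qed
    also have "\<dots> = (\<Sum>A\<in>Pow P. \<Prod>e\<in>A. if \<chi> (fst e) = \<chi> (snd e) then w e - 1 else 0)"
      using finP by (simp add: prod_add)
    also have "\<dots> = (\<Sum>A\<in>Pow P. if \<forall>(i, j)\<in>A. \<chi> i = \<chi> j then \<Prod>e\<in>A. w e - 1 else 0)"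
    proof (rule sum.cong[OF refl])
      fix A assume "A \<in> Pow P"
      then have "finite A" using finP finite_subset by blast
      then show "(\<Prod>e\<in>A. if \<chi> (fst e) = \<chi> (snd e) then w e - 1 else 0) =
          (if \<forall>(i, j)\<in>A. \<chi> i = \<chi> j then \<Prod>e\<in>A. w e - 1 else 0)"
        by (auto intro!: prod.cong prod_zero split: if_splits) force+
    qed
    finally show ?thesis .
  qed
  define p where "p = (\<Sum>A\<in>Pow P. monom ((\<Prod>e\<in>A. w e - 1) / Y ^ card V) (card (components V A)))"
  have "Poly_Mapping.lookup ((\<Sum>l \<in> V \<rightarrow>\<^sub>E {0, 1}. Poly_Mapping.single (exponent V l) (f l)) ^ N)
      (exponent V (\<lambda>_. 1)) = poly p (of_nat N)" for N
  proof -
    have fin: "finite (V \<rightarrow>\<^sub>E {..<N})" using assms(1) by (intro finite_PiE) auto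
    have "(\<Sum>\<chi> \<in> V \<rightarrow>\<^sub>E {..<N}. \<Prod>c<N. f (\<lambda>j\<in>V. of_bool (\<chi> j = c))) =
      (\<Sum>A\<in>Pow P. \<Sum>\<chi> \<in> V \<rightarrow>\<^sub>E {..<N}. if \<forall>(i, j)\<in>A. \<chi> i = \<chi> j then \<Prod>e\<in>A. w e - 1 else 0)
        * inverse Y ^ card V"
      by (subst sum.swap) (simp add: val sum_distrib_right)
    also have "(\<Sum>A\<in>Pow P. \<Sum>\<chi> \<in> V \<rightarrow>\<^sub>E {..<N}. if \<forall>(i, j)\<in>A. \<chi> i = \<chi> j then \<Prod>e\<in>A. w e - 1 else 0) =
      (\<Sum>A\<in>Pow P. (\<Prod>e\<in>A. w e - 1) * of_nat N ^ card (components V A))"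
    proof (rule sum.cong[OF refl])
      fix A assume "A \<in> Pow P"
      then have "card {\<chi> \<in> V \<rightarrow>\<^sub>E {..<N}. \<forall>(i, j)\<in>A. \<chi> i = \<chi> j} = N ^ card (components V A)"
        using card_colourings[of V A "{..<N}"] assms by auto
      then show "(\<Sum>\<chi> \<in> V \<rightarrow>\<^sub>E {..<N}. if \<forall>(i, j)\<in>A. \<chi> i = \<chi> j then \<Prod>e\<in>A. w e - 1 else 0) =
          (\<Prod>e\<in>A. w e - 1) * of_nat N ^ card (components V A)"
        using fin by (simp add: sum.inter_filter[symmetric] mult.commute)
    qed
    finally show ?thesis
      using lookup_power_colourings[OF assms(1), of f N]
      by (simp add: p_def poly_sum poly_monom sum_distrib_left field_class.field_divide_inverse
          power_inverse mult_ac del: One_nat_def restrict_apply)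
  qed
  then have "mpoly_fps_power (\<Sum>l \<in> V \<rightarrow>\<^sub>E {0, 1}. Poly_Mapping.single (exponent V l) (f l)) \<alpha>
      (exponent V (\<lambda>_. 1)) = poly p \<alpha>"
    by (intro mpoly_fps_power_eqI[of "card V"] lookup_power_minus_1_eq_0[where f = f] assms(1) f1)
  then show ?thesis
    by (simp add: p_def poly_sum poly_monom sum_divide_distrib)
qed

section \<open>Parallel edges\<close>

lemma sum_Pow_power_card:
  fixes Y :: "'a::comm_semiring_1"
  assumes "finite S"
  shows "(\<Sum>X\<in>Pow S. Y ^ card X) = (Y + 1) ^ card S"
  using prod_add[OF assms, of "\<lambda>_. Y" "\<lambda>_. 1"] by simp

text \<open>A set \<open>B\<close> lying over \<open>A\<close> is a choice of a nonempty fibre in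
  \<open>M e\<close> for each \<open>e \<in> A\<close>. The choices are independent, so the sum
  factorizes, and leaving out the empty fibre accounts for the \<open>- 1\<close>.\<close>

lemma sum_Pow_Sigma_fst_image:
  fixes Y :: "'a::comm_ring_1" and M :: "'e \<Rightarrow> 'k set"
  assumes "finite P" "\<And>e. e \<in> P \<Longrightarrow> finite (M e)"
  shows "(\<Sum>B\<in>Pow (Sigma P M). c (fst ` B) * Y ^ card B) =
    (\<Sum>A\<in>Pow P. c A * (\<Prod>e\<in>A. (Y + 1) ^ card (M e) - 1))"
proof -
  have "(\<Sum>B\<in>Pow (Sigma P M). c (fst ` B) * Y ^ card B) =
    (\<Sum>A\<in>Pow P. \<Sum>B | B \<in> Pow (Sigma P M) \<and> fst ` B = A. c (fst ` B) * Y ^ card B)"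
    using assms by (intro sum.group[symmetric]) auto
  also have "\<dots> = (\<Sum>A\<in>Pow P. c A * (\<Prod>e\<in>A. (Y + 1) ^ card (M e) - 1))"
  proof (rule sum.cong[OF refl])
    fix A assume A: "A \<in> Pow P"
    have finA: "finite A" and finM: "\<And>e. e \<in> A \<Longrightarrow> finite (M e)"
      using A assms by (auto intro: finite_subset)
    let ?G = "PiE A (\<lambda>e. Pow (M e) - {{}})"
    have "(\<Sum>B | B \<in> Pow (Sigma P M) \<and> fst ` B = A. Y ^ card B) = (\<Sum>g\<in>?G. Y ^ card (Sigma A g))"
    proof (rule sum.reindex_bij_witness[of _ "\<lambda>g. Sigma A g" "\<lambda>B. \<lambda>e\<in>A. B `` {e}"])
      fix B assume B: "B \<in> {B. B \<in> Pow (Sigma P M) \<and> fst ` B = A}"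
      have "e \<in> A" if "(e, k) \<in> B" for e k using B image_eqI[OF _ that, of e fst] by auto
      then show eq: "Sigma A (\<lambda>e\<in>A. B `` {e}) = B" by auto
      have "B `` {e} \<in> Pow (M e) - {{}}" if "e \<in> A" for e
        using B that by auto
      then show "(\<lambda>e\<in>A. B `` {e}) \<in> ?G" by (simp add: restrict_PiE_iff)
      show "Y ^ card (Sigma A (\<lambda>e\<in>A. B `` {e})) = Y ^ card B" by (simp add: eq)
    next
      fix g assume g: "g \<in> ?G"
      show "(\<lambda>e\<in>A. Sigma A g `` {e}) = g"
        using g by (intro extensionalityI[of _ A]) (auto simp: PiE_def)
      have "g e \<subseteq> M e" "g e \<noteq> {}" if "e \<in> A" for e
        using PiE_mem[OF g that] by auto
      then have "fst ` Sigma A g = A" "Sigma A g \<subseteq> Sigma P M"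
        using A by (auto simp: fst_image_Sigma)
      then show "Sigma A g \<in> {B. B \<in> Pow (Sigma P M) \<and> fst ` B = A}" by simp
    qed
    also have "\<dots> = (\<Sum>g\<in>?G. \<Prod>e\<in>A. Y ^ card (g e))"
    proof (rule sum.cong[OF refl])
      fix g assume "g \<in> ?G"
      then have "\<forall>e\<in>A. finite (g e)" using finM by (auto dest!: PiE_mem intro: finite_subset)
      then show "Y ^ card (Sigma A g) = (\<Prod>e\<in>A. Y ^ card (g e))"
        using finA by (simp add: card_SigmaI power_sum)
    qed
    also have "\<dots> = (\<Prod>e\<in>A. \<Sum>X\<in>Pow (M e) - {{}}. Y ^ card X)"
      using finA finM by (intro prod_sum_PiE[symmetric]) auto
    also have "\<dots> = (\<Prod>e\<in>A. (Y + 1) ^ card (M e) - 1)"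
      using finM by (intro prod.cong) (simp_all add: sum_diff1 sum_Pow_power_card)
    finally show "(\<Sum>B | B \<in> Pow (Sigma P M) \<and> fst ` B = A. c (fst ` B) * Y ^ card B) =
        c A * (\<Prod>e\<in>A. (Y + 1) ^ card (M e) - 1)"
      by (simp add: sum_distrib_left[symmetric] cong: conj_cong)
  qed
  finally show ?thesis .
qed

section \<open>The complete multigraph and its Tutte polynomial\<close>

lemma finite_vertex_pairs: "finite (vertex_pairs n)"
  by (rule finite_subset[of _ "{1..n} \<times> {1..n}"]) (auto simp: vertex_pairs_def)

lemma vertex_pairs_subset: "vertex_pairs n \<subseteq> {1..n} \<times> {1..n}"
  by (auto simp: vertex_pairs_def)

text \<open>Rebracketing presents the edges as a \<open>Sigma\<close> set over
  \<open>vertex_pairs n\<close>, with \<open>fst\<close> the projection to simple edges.\<close>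

definition parallel_edge :: "(nat \<times> nat) \<times> nat \<Rightarrow> nat \<times> nat \<times> nat" where
  "parallel_edge = (\<lambda>((i, j), k). (i, j, k))"

lemma inj_parallel_edge: "inj_on parallel_edge S"
  by (auto simp: parallel_edge_def inj_on_def)

lemma edges_complete_multigraph:
  "mg_edges (complete_multigraph n m) =
     parallel_edge ` Sigma (vertex_pairs n) (\<lambda>(i, j). {1..m i j})"
  by (force simp: complete_multigraph_def parallel_edge_def)

text \<open>Connectivity sees only which pairs carry an edge. An unordered end set can be read in
  both orders, which yields the symmetrized relation.\<close>

lemma num_components_complete_multigraph:
  "num_components (complete_multigraph n m) (parallel_edge ` B) =
     card (components {1..n} (fst ` B))"
proof -
  have "{(u, v). \<exists>e\<in>parallel_edge ` B. mg_ends (complete_multigraph n m) e = {u, v}} =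
      fst ` B \<union> (fst ` B)\<inverse>"
    by (force simp: complete_multigraph_def parallel_edge_def doubleton_eq_iff)
  then show ?thesis
    by (simp add: num_components_def components_def connected_pairs_def mg_connected_def
        complete_multigraph_def)
qed

lemma components_vertex_pairs:
  assumes "n \<ge> 1"
  shows "card (components {1..n} (vertex_pairs n)) = 1"
proof -
  have "connected_pairs {1..n} (vertex_pairs n) = {1..n} \<times> {1..n}"
  proof -
    have "(i, j) \<in> (vertex_pairs n \<union> (vertex_pairs n)\<inverse>)\<^sup>*" if "i \<in> {1..n}" "j \<in> {1..n}" for i j
      using that by (cases i j rule: linorder_cases) (auto simp: vertex_pairs_def)
    then show ?thesis by (auto simp: connected_pairs_def)
  qed
  then have "components {1..n} (vertex_pairs n) = {{1..n}}"
    using assms by (auto simp: components_def quotient_def)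
  then show ?thesis by simp
qed

lemma yP_neq_1: "yP - 1 \<noteq> 0"
  by (simp add: yP_def one_pCons)

lemma xP_neq_1: "xP - 1 \<noteq> 0"
  by (simp add: xP_def one_pCons)

lemma q_number_mult: "(yP - 1) * q_number m = yP ^ m - 1"
  by (simp add: q_number_def power_diff_1_eq yP_neq_1)

text \<open>Edge sets are grouped by the simple edges below them. Both sides are compared after
  multiplication by \<open>(yP - 1) ^ n\<close>, which is cancelled at the end.\<close>

lemma tutte_poly_complete_multigraph:
  assumes "n \<ge> 1"
    and "\<And>i j. 1 \<le> i \<Longrightarrow> i < j \<Longrightarrow> j \<le> n \<Longrightarrow> m i j > 0"
  shows "tutte_poly (complete_multigraph n m) =
    (\<Sum>A\<in>Pow (vertex_pairs n). (xP - 1) ^ (card (components {1..n} A) - 1) *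
       (yP - 1) ^ (card (components {1..n} A) + card A - n) *
       (\<Prod>(i, j)\<in>A. q_number (m i j)))"
    (is "_ = (\<Sum>A\<in>_. ?x A * ?y A * _ A)")
proof -
  let ?P = "vertex_pairs n" and ?M = "\<lambda>(i, j). {1..m i j}" and ?k = "\<lambda>A. card (components {1..n} A)"
  let ?Y = "yP - 1"
  have finS: "finite (Sigma ?P ?M)"
    using finite_vertex_pairs by (intro finite_SigmaI) auto
  \<comment> \<open>Positive multiplicities enter here: every pair carries an edge, so the whole
    graph is connected.\<close>
  have "fst ` Sigma ?P ?M = ?P"
    using assms(2) by (force simp: fst_image_Sigma vertex_pairs_def)
  then have kE: "num_components (complete_multigraph n m) (mg_edges (complete_multigraph n m)) = 1"
    using components_vertex_pairs[OF assms(1)]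
    by (simp add: edges_complete_multigraph num_components_complete_multigraph)
  have v: "card (mg_verts (complete_multigraph n m)) = n"
    by (simp add: complete_multigraph_def)
  have "tutte_poly (complete_multigraph n m) =
    (\<Sum>B \<in> Pow (Sigma ?P ?M). ?x (fst ` B) * ?Y ^ (?k (fst ` B) + card B - n))"
  proof -
    have "Pow (mg_edges (complete_multigraph n m)) = image parallel_edge ` Pow (Sigma ?P ?M)"
      by (simp add: edges_complete_multigraph image_Pow_surj)
    then have "tutte_poly (complete_multigraph n m) = (\<Sum>B \<in> Pow (Sigma ?P ?M).
        (xP - 1) ^ (num_components (complete_multigraph n m) (parallel_edge ` B) - 1) *
        ?Y ^ (num_components (complete_multigraph n m) (parallel_edge ` B) +
          card (parallel_edge ` B) - n))"
      unfolding tutte_poly_def kE v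
      by (simp only: sum.reindex[OF inj_on_image_Pow[OF inj_parallel_edge]] o_def)
    then show ?thesis
      by (simp only: num_components_complete_multigraph card_image[OF inj_parallel_edge])
  qed
  \<comment> \<open>The factor \<open>?Y ^ n\<close> absorbs the subtraction in the exponent, so
    that \<open>?Y ^ card B\<close> splits off and the grouping lemma applies.\<close>
  then have "?Y ^ n * tutte_poly (complete_multigraph n m) =
    (\<Sum>B \<in> Pow (Sigma ?P ?M). ?x (fst ` B) * ?Y ^ ?k (fst ` B) * ?Y ^ card B)"
    unfolding sum_distrib_left
  proof (simp only:, unfold sum_distrib_left, intro sum.cong refl)
    fix B assume B: "B \<in> Pow (Sigma ?P ?M)"
    then have "finite B" using finS finite_subset by blast
    then have "card (fst ` B) \<le> card B" by (rule card_image_le)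
    moreover have "fst ` B \<subseteq> {1..n} \<times> {1..n}" using B vertex_pairs_subset by fastforce
    ultimately have "n \<le> ?k (fst ` B) + card B"
      using card_le_components_plus_edges[of "{1..n}" "fst ` B"] \<open>finite B\<close> by simp
    then have "?Y ^ n * ?Y ^ (?k (fst ` B) + card B - n) = ?Y ^ (?k (fst ` B) + card B)"
      by (simp flip: power_add)
    then show "?Y ^ n * (?x (fst ` B) * ?Y ^ (?k (fst ` B) + card B - n)) =
        ?x (fst ` B) * ?Y ^ ?k (fst ` B) * ?Y ^ card B"
      by (simp add: power_add mult_ac)
  qed
  also have "\<dots> = (\<Sum>A\<in>Pow ?P. ?x A * ?Y ^ ?k A * (\<Prod>e\<in>A. (?Y + 1) ^ card (?M e) - 1))"
    by (rule sum_Pow_Sigma_fst_image) (auto simp: finite_vertex_pairs)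
  also have "\<dots> = ?Y ^ n * (\<Sum>A\<in>Pow ?P. ?x A * ?y A * (\<Prod>(i, j)\<in>A. q_number (m i j)))"
    unfolding sum_distrib_left
  proof (intro sum.cong refl)
    fix A assume A: "A \<in> Pow ?P"
    then have "finite A" using finite_vertex_pairs finite_subset by blast
    then have "n \<le> ?k A + card A"
      using card_le_components_plus_edges[of "{1..n}" A] A vertex_pairs_subset[of n] by auto
    then have y: "?Y ^ n * ?y A = ?Y ^ ?k A * ?Y ^ card A"
      by (simp flip: power_add)
    \<comment> \<open>Each simple edge yields y^m - 1 = (y - 1) [m]_y; the factors y - 1 supply the
      summand |A| of the exponent.\<close>
    have "(\<Prod>e\<in>A. (?Y + 1) ^ card (?M e) - 1) = (\<Prod>e\<in>A. ?Y * (case e of (i, j) \<Rightarrow> q_number (m i j)))"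
      by (intro prod.cong) (auto simp: q_number_mult)
    also have "\<dots> = ?Y ^ card A * (\<Prod>(i, j)\<in>A. q_number (m i j))"
      by (simp add: prod.distrib)
    finally have "?x A * ?Y ^ ?k A * (\<Prod>e\<in>A. (?Y + 1) ^ card (?M e) - 1) =
        ?x A * (?Y ^ ?k A * ?Y ^ card A) * (\<Prod>(i, j)\<in>A. q_number (m i j))"
      by (simp only: mult_ac)
    also have "\<dots> = ?Y ^ n * (?x A * ?y A * (\<Prod>(i, j)\<in>A. q_number (m i j)))"
      unfolding y[symmetric] by (simp only: mult_ac)
    finally show "?x A * ?Y ^ ?k A * (\<Prod>e\<in>A. (?Y + 1) ^ card (?M e) - 1) =
        ?Y ^ n * (?x A * ?y A * (\<Prod>(i, j)\<in>A. q_number (m i j)))" .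
  qed
  finally show ?thesis using yP_neq_1 by simp
qed

section \<open>The universal Tutte polynomial\<close>

lemma mpoly_const_simps:
  "mpoly_const (1::'a::comm_ring_1) = (1 :: ('v, 'a) mpoly)"
  "mpoly_const (a - b) = (mpoly_const a - mpoly_const b :: ('v, 'a) mpoly)"
  "mpoly_const (a * b) = (mpoly_const a * mpoly_const b :: ('v, 'a) mpoly)"
  by (simp_all add: mpoly_const_def single_diff mult_single)

lemma mpoly_const_power:
  "mpoly_const (a ^ k) = (mpoly_const a ^ k :: ('v, 'a::comm_ring_1) mpoly)"
  by (induction k) (simp_all add: mpoly_const_simps)

lemma mpoly_const_eq_iff: "mpoly_const a = mpoly_const b \<longleftrightarrow> a = b"
  unfolding mpoly_const_def by (metis lookup_single_eq)

lemma mpoly_var_power: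
  "mpoly_var v ^ k = (Poly_Mapping.single (Poly_Mapping.single v k) 1 :: ('v, 'a::comm_semiring_1) mpoly)"
  by (induction k) (simp_all add: mpoly_var_def mult_single flip: single_add)

text \<open>Translates between products of variables, as in \<open>tutte_base\<close>, and single
  terms, as in the coefficient computations.\<close>

lemma single_exponent:
  "Poly_Mapping.single (exponent V l) c =
     (mpoly_const c * (\<Prod>v\<in>V. mpoly_var v ^ l v) :: ('v, 'a::comm_semiring_1) mpoly)"
  by (simp add: mpoly_const_def mpoly_var_power prod_single mult_single exponent_def)

lemma keys_exponent_1: "finite A \<Longrightarrow> Poly_Mapping.keys (exponent A (\<lambda>_. 1)) = A"
  by (auto simp: lookup_exponent in_keys_iff split: if_splits)

section \<open>Evaluation of polynomials\<close>

lemma mpoly_eval_add: "mpoly_eval f (p + q) = mpoly_eval f p + mpoly_eval f q"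
proof -
  \<comment> \<open>Cancellation may remove monomials from the sum, so all three evaluations are
    taken over this common set.\<close>
  let ?S = "Poly_Mapping.keys p \<union> Poly_Mapping.keys q"
  let ?m = "\<lambda>\<mu>. \<Prod>v\<in>Poly_Mapping.keys \<mu>. f v ^ Poly_Mapping.lookup \<mu> v"
  have *: "mpoly_eval f r = (\<Sum>\<mu>\<in>?S. Poly_Mapping.lookup r \<mu> * ?m \<mu>)"
    if "Poly_Mapping.keys r \<subseteq> ?S" for r
    unfolding mpoly_eval_def using that
    by (intro sum.mono_neutral_left) (auto simp: in_keys_iff)
  show ?thesis
    using keys_add[of p q] by (simp add: * lookup_add distrib_right sum.distrib)
qed

lemma mpoly_eval_sum: "mpoly_eval f (\<Sum>i\<in>I. p i) = (\<Sum>i\<in>I. mpoly_eval f (p i))"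
  by (induction I rule: infinite_finite_induct) (simp_all add: mpoly_eval_add, simp_all add: mpoly_eval_def)

lemma mpoly_eval_single:
  "mpoly_eval f (Poly_Mapping.single \<mu> c) =
     c * (\<Prod>v\<in>Poly_Mapping.keys \<mu>. f v ^ Poly_Mapping.lookup \<mu> v)"
  by (cases "c = 0") (simp_all add: mpoly_eval_def)

section \<open>Passage to fractions and the explicit expansion\<close>

lemma to_fract_power: "to_fract (a ^ k) = to_fract a ^ k"
  by (induction k) simp_all

lemma to_fract_prod: "to_fract (\<Prod>i\<in>I. p i) = (\<Prod>i\<in>I. to_fract (p i))"
  by (induction I rule: infinite_finite_induct) simp_all

lemma to_fract_sum: "to_fract (\<Sum>i\<in>I. p i) = (\<Sum>i\<in>I. to_fract (p i))"
  by (induction I rule: infinite_finite_induct) simp_all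

lemma xK_neq_1: "xK - 1 \<noteq> 0" and yK_neq_1: "yK - 1 \<noteq> 0"
  using xP_neq_1 yP_neq_1
  by (simp_all add: xK_def yK_def mpoly_const_eq_iff
      flip: to_fract_1 to_fract_diff mpoly_const_simps(1))

text \<open>The edge-weighted Tutte polynomial of the complete graph. For \<open>n \<ge> 1\<close>
  neither subtraction truncates.\<close>

definition tutte_expansion :: "nat \<Rightarrow> qxy_poly" where
  "tutte_expansion n = (\<Sum>A\<in>Pow (vertex_pairs n). Poly_Mapping.single (exponent A (\<lambda>_. 1))
     ((xP - 1) ^ (card (components {1..n} A) - 1) *
      (yP - 1) ^ (card (components {1..n} A) + card A - n)))"

lemma finite_subset_vertex_pairs: "A \<in> Pow (vertex_pairs n) \<Longrightarrow> finite A"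
  using finite_vertex_pairs finite_subset by blast

lemma mpoly_vars_tutte_expansion: "mpoly_vars (tutte_expansion n) \<subseteq> vertex_pairs n"
proof
  fix e assume "e \<in> mpoly_vars (tutte_expansion n)"
  then obtain \<mu> where \<mu>: "\<mu> \<in> Poly_Mapping.keys (tutte_expansion n)" "e \<in> Poly_Mapping.keys \<mu>"
    by (auto simp: mpoly_vars_def)
  from subsetD[OF keys_sum \<mu>(1)[unfolded tutte_expansion_def]] obtain A
    where A: "A \<in> Pow (vertex_pairs n)" "\<mu> = exponent A (\<lambda>_. 1)"
    by (auto split: if_splits)
  then show "e \<in> vertex_pairs n"
    using \<mu>(2) keys_exponent_1[OF finite_subset_vertex_pairs[OF A(1)]] by auto
qed

lemma mpoly_eval_tutte_expansion:
  "mpoly_eval f (tutte_expansion n) =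
    (\<Sum>A\<in>Pow (vertex_pairs n). (xP - 1) ^ (card (components {1..n} A) - 1) *
       (yP - 1) ^ (card (components {1..n} A) + card A - n) * (\<Prod>e\<in>A. f e))"
  unfolding tutte_expansion_def mpoly_eval_sum mpoly_eval_single
  by (intro sum.cong refl arg_cong2[where f = "(*)"] prod.cong)
    (simp_all add: finite_subset_vertex_pairs keys_exponent_1 lookup_exponent del: One_nat_def)

lemma tutte_base_eq:
  "tutte_base n = (\<Sum>l \<in> {1..n} \<rightarrow>\<^sub>E {0, 1}. Poly_Mapping.single (exponent {1..n} l)
     ((\<Prod>(i, j)\<in>vertex_pairs n. (qK (i, j) * (yK - 1) + 1) ^ (l i * l j)) *
      (yK - 1) powi (- int (\<Sum>j\<in>{1..n}. l j))))"
  unfolding tutte_base_def single_exponent ..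

text \<open>With edge weight q_e (y - 1) + 1 and exponent (x - 1)(y - 1), the term of
  \<open>A\<close> carries (x - 1)^\<kappa>(A) and (y - 1)^(\<kappa>(A) + |A| - n). Since
  \<open>n \<ge> 1\<close> forces \<kappa>(A) \<ge> 1, one factor x - 1 can be split off.\<close>

lemma tutte_expansion_eq:
  assumes "n \<ge> 1"
  shows "(xK - 1) * to_fract (tutte_expansion n) =
    mpoly_fps_power (tutte_base n) ((xK - 1) * (yK - 1)) (\<Sum>j = 1..n. Poly_Mapping.single j 1)"
proof -
  let ?k = "\<lambda>A. card (components {1..n} A)"
  have "mpoly_fps_power (tutte_base n) ((xK - 1) * (yK - 1)) (exponent {1..n} (\<lambda>_. 1)) =
    (\<Sum>A\<in>Pow (vertex_pairs n). (\<Prod>e\<in>A. (qK e * (yK - 1) + 1) - 1) * ((xK - 1) * (yK - 1)) ^ ?k A)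
      / (yK - 1) ^ card {1..n}"
    unfolding tutte_base_eq
    by (rule mpoly_fps_power_components[OF _ vertex_pairs_subset]) auto
  also have "\<dots> = (\<Sum>A\<in>Pow (vertex_pairs n). (xK - 1) *
      ((xK - 1) ^ (?k A - 1) * (yK - 1) ^ (?k A + card A - n) * (\<Prod>e\<in>A. qK e)))"
    unfolding sum_divide_distrib
  proof (rule sum.cong[OF refl])
    fix A assume A: "A \<in> Pow (vertex_pairs n)"
    have "n \<le> ?k A + card A"
      using card_le_components_plus_edges[of "{1..n}" A] A vertex_pairs_subset[of n]
        finite_subset_vertex_pairs[OF A] by auto
    then have y: "(yK - 1) ^ (?k A + card A - n) = (yK - 1) ^ ?k A * (yK - 1) ^ card A / (yK - 1) ^ n"
      using yK_neq_1 by (simp add: power_diff power_add)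
    have "?k A > 0" using assms by (intro card_components_pos) auto
    then have x: "(xK - 1) ^ ?k A = (xK - 1) * (xK - 1) ^ (?k A - 1)"
      by (simp flip: power_Suc)
    show "(\<Prod>e\<in>A. (qK e * (yK - 1) + 1) - 1) * ((xK - 1) * (yK - 1)) ^ ?k A / (yK - 1) ^ card {1..n} =
      (xK - 1) * ((xK - 1) ^ (?k A - 1) * (yK - 1) ^ (?k A + card A - n) * (\<Prod>e\<in>A. qK e))"
      unfolding y power_mult_distrib x by (simp add: prod.distrib)
  qed
  also have "\<dots> = (xK - 1) * to_fract (tutte_expansion n)"
    by (simp add: tutte_expansion_def to_fract_sum single_exponent mpoly_const_simps
        mpoly_const_power to_fract_power to_fract_prod xK_def yK_def qK_def sum_distrib_left)
  finally show ?thesis by (simp add: exponent_def)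
qed

text \<open>The expansion is a witness for the description; uniqueness follows by cancelling the
  nonzero \<open>xK - 1\<close> in the field of fractions and injectivity of
  \<open>to_fract\<close>.\<close>

lemma universal_tutte_eq:
  assumes "n \<ge> 1"
  shows "universal_tutte n = tutte_expansion n"
  unfolding universal_tutte_def
proof (rule the_equality)
  show "mpoly_vars (tutte_expansion n) \<subseteq> vertex_pairs n \<and>
    (xK - 1) * to_fract (tutte_expansion n) =
    mpoly_fps_power (tutte_base n) ((xK - 1) * (yK - 1)) (\<Sum>j = 1..n. Poly_Mapping.single j 1)"
    using mpoly_vars_tutte_expansion tutte_expansion_eq[OF assms] by blast
next
  fix T assume "mpoly_vars T \<subseteq> vertex_pairs n \<and> (xK - 1) * to_fract T =
    mpoly_fps_power (tutte_base n) ((xK - 1) * (yK - 1)) (\<Sum>j = 1..n. Poly_Mapping.single j 1)"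
  then have "(xK - 1) * to_fract T = (xK - 1) * to_fract (tutte_expansion n)"
    using tutte_expansion_eq[OF assms] by simp
  then show "T = tutte_expansion n" using xK_neq_1 by simp
qed

theorem corollary4p2:
  fixes n :: nat and m :: "nat \<Rightarrow> nat \<Rightarrow> nat"
  assumes "n \<ge> 1"
    and "\<And>i j. 1 \<le> i \<Longrightarrow> i < j \<Longrightarrow> j \<le> n \<Longrightarrow> m i j > 0"
  shows "mpoly_eval (\<lambda>(i, j). q_number (m i j)) (universal_tutte n)
           = tutte_poly (complete_multigraph n m)"
  using tutte_poly_complete_multigraph[OF assms]
  by (simp add: universal_tutte_eq[OF assms(1)] mpoly_eval_tutte_expansion)

end
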